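(* Consider the CBI-process on $\mathbb{R}_+$ with generator $$Lf(x)=axf''(x)-bxf'(x)+x\int_0^\infty[f(x+y)-f(x)-yf'(x)]\,n_1(dy)+\delta f'(x)+\int_0^\infty[f(x+y)-f(x)]\,n_2(dy),$$ where $a,b,\delta\ge 0$ and $n_1,n_2$ are measures on $(0,\infty)$ with $\int_0^\infty\min\{y^2,y\}n_1(dy)+\int_{(0,1)}y\,n_2(dy)+\int_{[1,\infty)}(1+\log y)\,n_2(dy)<\infty$, and such that neither $R\equiv0$ nor $F\equiv0$. If this process has a nondegenerate (i.e. not a point mass) reversible distribution, then the process is a CIR model, i.e. $n_1\equiv0$, $n_2\equiv0$ and $a>0$, $b>0$, $\delta>0$.
   Context: $R(\lambda)=-a\lambda^2-b\lambda-\int_0^\infty(e^{-\lambda y}-1+\lambda y)n_1(dy)$ and $F(\lambda)=\delta\lambda+\int_0^\infty(1-e^{-\lambda y})n_2(dy)$ for $\lambda\ge0$. A probability measure $\nu$ on $\mathbb{R}_+$ is reversible if it is stationary and the bilinear form $\mathcal{E}(f,g)=-\int Lf\cdot g\,d\nu$ is symmetric on the domain of $L$ (which contains the functions $x\mapsto e^{-\lambda x}$, $\lambda\ge0$). In the CIR case the stationary distribution is the gamma distribution with parameter $(\delta/a,b/a)$. *)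

theory Defs
  imports "HOL-Probability.Probability"
begin

definition cbi_admissible :: "real measure \<Rightarrow> real measure \<Rightarrow> bool" where
  "cbi_admissible n1 n2 \<longleftrightarrow>
     sets n1 = sets borel \<and> sets n2 = sets borel \<and>
     emeasure n1 {..0} = 0 \<and> emeasure n2 {..0} = 0 \<and>
     (\<integral>\<^sup>+ y. ennreal (min (y^2) y) \<partial>n1)
       + (\<integral>\<^sup>+ y. ennreal (indicator {0<..<1} y * y) \<partial>n2)
       + (\<integral>\<^sup>+ y. ennreal (indicator {1..} y * (1 + ln y)) \<partial>n2) < \<infinity>"

definition cbi_R :: "real \<Rightarrow> real \<Rightarrow> real measure \<Rightarrow> real \<Rightarrow> real" where
  "cbi_R a b n1 l = - a * l^2 - b * l - (\<integral> y. (exp (-l*y) - 1 + l*y) \<partial>n1)"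

definition cbi_F :: "real \<Rightarrow> real measure \<Rightarrow> real \<Rightarrow> real" where
  "cbi_F \<delta> n2 l = \<delta> * l + (\<integral> y. (1 - exp (-l*y)) \<partial>n2)"

definition cbi_gen :: "real \<Rightarrow> real \<Rightarrow> real \<Rightarrow> real measure \<Rightarrow> real measure
     \<Rightarrow> (real \<Rightarrow> real) \<Rightarrow> real \<Rightarrow> real" where
  "cbi_gen a b \<delta> n1 n2 f x =
     a * x * deriv (deriv f) x - b * x * deriv f x
     + x * (\<integral> y. (f (x + y) - f x - y * deriv f x) \<partial>n1)
     + \<delta> * deriv f x
     + (\<integral> y. (f (x + y) - f x) \<partial>n2)"

text \<open>Reversible distribution: a probability measure on R_+ such that, for the domain D
  of L (which contains all x \<mapsto> exp(-l x), l \<ge> 0), nu is stationary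
  (integral of L f vanishes) and the form -\<integral> Lf g d\<nu> is symmetric on D.\<close>
definition cbi_reversible :: "real \<Rightarrow> real \<Rightarrow> real \<Rightarrow> real measure \<Rightarrow> real measure
     \<Rightarrow> real measure \<Rightarrow> bool" where
  "cbi_reversible a b \<delta> n1 n2 \<nu> \<longleftrightarrow>
     prob_space \<nu> \<and> sets \<nu> = sets borel \<and> emeasure \<nu> {..<0} = 0 \<and>
     (\<exists>D. (\<forall>l\<ge>0. (\<lambda>x. exp (-l*x)) \<in> D) \<and>
          (\<forall>f\<in>D. (\<integral> x. cbi_gen a b \<delta> n1 n2 f x \<partial>\<nu>) = 0) \<and>
          (\<forall>f\<in>D. \<forall>g\<in>D. (\<integral> x. cbi_gen a b \<delta> n1 n2 f x * g x \<partial>\<nu>)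
                         = (\<integral> x. f x * cbi_gen a b \<delta> n1 n2 g x \<partial>\<nu>)))"

end

theory Submission
  imports Defs
begin

text \<open>
  On \<open>f\<^sub>l(x) = exp(-l x)\<close> the generator acts by \<open>L f\<^sub>l(x) = - exp(-l x) (x R(l) + F(l))\<close>. With
  \<open>G(l) = \<integral> exp(-l x) d\<nu>\<close> and \<open>H(l) = \<integral> x exp(-l x) d\<nu>\<close>, stationarity gives
  \<open>R(l) H(l) + F(l) G(l) = 0\<close> and symmetry gives
  \<open>(R(l) - R(m)) H(l+m) + (F(l) - F(m)) G(l+m) = 0\<close>. Take stationarity at \<open>4\<close> minus twice
  symmetry at \<open>(3, 1)\<close>: the contributions of \<open>a\<close>, \<open>b\<close>, \<open>\<delta>\<close> cancel, and the rest is
  \<open>H(4) \<integral> k dn\<^sub>1 + G(4) \<integral> k dn\<^sub>2 = 0\<close> with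
  \<open>k(y) = 1 - 2z + 2z^3 - z^4 = (1-z)^3 (1+z)\<close>, \<open>z = exp(-y)\<close>, which is positive for \<open>y > 0\<close>.
  Hence \<open>n\<^sub>1 = n\<^sub>2 = 0\<close>, and stationarity reads \<open>(a l + b) H(l) = \<delta> G(l)\<close>. If \<open>a = 0\<close>, comparing
  \<open>l = 1\<close> and \<open>l = 2\<close> forces \<open>\<nu>\<close> to be a point mass; if \<open>b = 0\<close>, letting \<open>l \<rightarrow> 0\<close> gives \<open>\<delta> = 0\<close>.
\<close>

section \<open>The kernel selecting the jump measures\<close>

definition cbi_kernel :: "real \<Rightarrow> real" where
  "cbi_kernel y = (1 - exp (-y))^3 * (1 + exp (-y))"

text \<open>The weights 1, -2, 2 at the exponents 4, 3, 1 satisfy 4 - 2*3 + 2*1 = 0 and 16 - 2*9 +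
  2*1 = 0, so terms linear or quadratic in the exponent drop out of the same combination.\<close>

lemma cbi_kernel_eq:
  "cbi_kernel y = 1 - exp (-4*y) - 2 * (1 - exp (-3*y)) + 2 * (1 - exp (-1*y))"
proof -
  have "exp (-3*y) = exp (-y)^3" "exp (-4*y) = exp (-y)^4"
    by (simp_all flip: exp_of_nat_mult)
  then show ?thesis
    unfolding cbi_kernel_def by (simp add: algebra_simps power_numeral_reduce)
qed

lemma cbi_kernel_pos: "0 < y \<Longrightarrow> 0 < cbi_kernel y"
  unfolding cbi_kernel_def by (intro mult_pos_pos zero_less_power) (auto intro: add_pos_pos)

section \<open>The generator on exponentials\<close>

lemma deriv_exp_mult: "deriv (\<lambda>x::real. exp (c * x)) = (\<lambda>x. c * exp (c * x))"
  by (rule ext, rule DERIV_imp_deriv) (auto intro!: derivative_eq_intros)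

lemma deriv_deriv_exp_mult:
  "deriv (deriv (\<lambda>x::real. exp (c * x))) = (\<lambda>x. c^2 * exp (c * x))"
  unfolding deriv_exp_mult
  by (rule ext, rule DERIV_imp_deriv) (auto intro!: derivative_eq_intros simp: power2_eq_square)

text \<open>Each jump integrand is a multiple, by the factor \<open>exp (-l*x)\<close>, of the
  integrand in \<open>cbi_R\<close> or \<open>cbi_F\<close>. Only this factor is pulled out and no
  integral is split, so integrability is not an issue here.\<close>

lemma cbi_gen_exp:
  "cbi_gen a b \<delta> n1 n2 (\<lambda>x. exp (-l*x)) x
     = - cbi_R a b n1 l * (x * exp (-l*x)) - cbi_F \<delta> n2 l * exp (-l*x)"
proof -
  have e: "exp (-l*(x+y)) = exp (-l*x) * exp (-l*y)" for y
    by (simp add: algebra_simps flip: exp_add)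
  have 1: "(\<integral>y. exp (-l*(x+y)) - exp (-l*x) - y * (-l * exp (-l*x)) \<partial>n1)
      = exp (-l*x) * (\<integral>y. exp (-l*y) - 1 + l*y \<partial>n1)"
    unfolding e
    by (subst integral_mult_right_zero[symmetric], rule arg_cong[where f="integral\<^sup>L n1"])
       (simp add: fun_eq_iff algebra_simps)
  have 2: "(\<integral>y. exp (-l*(x+y)) - exp (-l*x) \<partial>n2)
      = exp (-l*x) * (- (\<integral>y. 1 - exp (-l*y) \<partial>n2))"
    unfolding e
    by (subst Bochner_Integration.integral_minus[symmetric],
        subst integral_mult_right_zero[symmetric], rule arg_cong[where f="integral\<^sup>L n2"])
       (simp add: fun_eq_iff algebra_simps)
  show ?thesis
    unfolding cbi_gen_def deriv_deriv_exp_mult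
    unfolding deriv_exp_mult 1 2 cbi_R_def cbi_F_def
    by (simp add: algebra_simps power2_eq_square)
qed

section \<open>Integrability of the jump integrands\<close>

lemma AE_pos_of_null_atMost:
  assumes "sets n = sets borel" and "emeasure n {..0::real} = 0"
  shows "AE y in n. 0 < y"
  by (rule AE_I[where N="{..0}"]) (use assms in \<open>auto simp: not_less\<close>)

text \<open>Passes from the extended-valued integrals in \<open>cbi_admissible\<close> to Bochner
  integrability.\<close>

lemma integrable_of_nn_integral_bound:
  fixes f g :: "'a \<Rightarrow> real"
  assumes "f \<in> borel_measurable M" and "g \<in> borel_measurable M"
    and "(\<integral>\<^sup>+ x. ennreal (g x) \<partial>M) < \<infinity>"
    and "AE x in M. 0 \<le> f x \<and> f x \<le> C * g x" and "0 \<le> C"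
  shows "integrable M f"
proof (rule integrableI_bounded)
  have "(\<integral>\<^sup>+ x. ennreal (norm (f x)) \<partial>M) \<le> (\<integral>\<^sup>+ x. ennreal C * ennreal (g x) \<partial>M)"
  proof (rule nn_integral_mono_AE)
    show "AE x in M. ennreal (norm (f x)) \<le> ennreal C * ennreal (g x)"
      using assms(4) by eventually_elim (simp add: ennreal_leI flip: ennreal_mult'[OF assms(5)])
  qed
  also have "\<dots> = ennreal C * (\<integral>\<^sup>+ x. ennreal (g x) \<partial>M)"
    using assms(2) by (intro nn_integral_cmult) simp
  also have "\<dots> < \<infinity>"
    using assms(3) by (simp add: ennreal_mult_less_top)
  finally show "(\<integral>\<^sup>+ x. ennreal (norm (f x)) \<partial>M) < \<infinity>" .
qed (fact assms(1))

lemma exp_minus_Taylor1_le: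
  fixes u :: real
  assumes "0 \<le> u"
  shows "exp (-u) - 1 + u \<le> u^2"
proof (cases "u \<le> 1")
  case True
  have "(1 + u) * exp (-u) \<le> 1"
    using exp_ge_add_one_self[of u] by (simp add: exp_minus field_simps)
  then have "exp (-u) \<le> 1 / (1 + u)"
    using assms by (simp add: field_simps)
  \<comment> \<open>This uses (1 + u) (1 - u + u^2) = 1 + u^3.\<close>
  also have "1 / (1 + u) \<le> 1 - u + u^2"
    using assms by (simp add: field_simps power2_eq_square)
  finally show ?thesis by simp
next
  case False
  then have "u * 1 \<le> u * u" by (intro mult_left_mono) auto
  moreover have "exp (-u) \<le> 1" using assms by simp
  ultimately show ?thesis unfolding power2_eq_square by linarith
qed

text \<open>The integrand is at most (l y)^2 and at most l y; the constant \<open>l^2 + l\<close>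
  dominates both coefficients.\<close>

lemma cbi_R_integrable:
  assumes "cbi_admissible n1 n2" and "0 \<le> l"
  shows "integrable n1 (\<lambda>y. exp (-l*y) - 1 + l*y)"
proof (rule integrable_of_nn_integral_bound[where g="\<lambda>y. min (y^2) y" and C="l^2 + l"])
  have [measurable_cong]: "sets n1 = sets borel" and null: "emeasure n1 {..0} = 0"
    using assms(1) by (auto simp: cbi_admissible_def)
  show "(\<lambda>y. exp (-l*y) - 1 + l*y) \<in> borel_measurable n1"
       "(\<lambda>y. min (y^2) y) \<in> borel_measurable n1"
    by measurable
  show "(\<integral>\<^sup>+ y. ennreal (min (y^2) y) \<partial>n1) < \<infinity>"
    using assms(1) by (auto simp: cbi_admissible_def)
  show "AE y in n1. 0 \<le> exp (-l*y) - 1 + l*y \<and> exp (-l*y) - 1 + l*y \<le> (l^2 + l) * min (y^2) y"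
    using AE_pos_of_null_atMost[OF \<open>sets n1 = sets borel\<close> null]
  proof eventually_elim
    case (elim y)
    have ly: "0 \<le> l * y" using elim assms(2) by simp
    have sq: "exp (-l*y) - 1 + l*y \<le> l^2 * y^2"
      using exp_minus_Taylor1_le[OF ly] by (simp add: power_mult_distrib)
    have lin: "exp (-l*y) - 1 + l*y \<le> l * y" using ly by simp
    have "l^2 * y^2 \<le> (l^2 + l) * y^2" "l * y \<le> (l^2 + l) * y"
      using elim assms(2) by (auto intro!: mult_right_mono)
    note bounds = order_trans[OF sq this(1)] order_trans[OF lin this(2)]
    have "exp (-l*y) - 1 + l*y \<le> (l^2 + l) * min (y^2) y"
      unfolding min_def by (rule if_split[THEN iffD2]) (use bounds in blast)
    moreover have "0 \<le> exp (-l*y) - 1 + l*y"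
      using exp_ge_add_one_self[of "-l*y"] by simp
    ultimately show ?case by simp
  qed
qed (use assms(2) in simp)

text \<open>The bound l y serves for small jumps and the bound 1 for jumps of size at least 1; the
  constant \<open>1 + l\<close> covers both.\<close>

lemma cbi_F_integrable:
  assumes "cbi_admissible n1 n2" and "0 \<le> l"
  shows "integrable n2 (\<lambda>y. 1 - exp (-l*y))"
proof (rule integrable_of_nn_integral_bound
    [where g="\<lambda>y. indicator {0<..<1} y * y + indicator {1..} y * (1 + ln y)" and C="1 + l"])
  have [measurable_cong]: "sets n2 = sets borel" and null: "emeasure n2 {..0} = 0"
    using assms(1) by (auto simp: cbi_admissible_def)
  show "(\<lambda>y. 1 - exp (-l*y)) \<in> borel_measurable n2"
       "(\<lambda>y. indicator {0<..<1} y * y + indicator {1..} y * (1 + ln y)) \<in> borel_measurable n2"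
    by measurable
  have "(\<integral>\<^sup>+ y. ennreal (indicator {0<..<1} y * y + indicator {1..} y * (1 + ln y)) \<partial>n2)
      = (\<integral>\<^sup>+ y. ennreal (indicator {0<..<1} y * y) + ennreal (indicator {1..} y * (1 + ln y)) \<partial>n2)"
    by (intro nn_integral_cong ennreal_plus) (auto simp: indicator_def)
  also have "\<dots> = (\<integral>\<^sup>+ y. ennreal (indicator {0<..<1} y * y) \<partial>n2)
      + (\<integral>\<^sup>+ y. ennreal (indicator {1..} y * (1 + ln y)) \<partial>n2)"
    by (intro nn_integral_add) measurable
  also have "\<dots> < \<infinity>"
    using assms(1) by (auto simp: cbi_admissible_def)
  finally show "(\<integral>\<^sup>+ y. ennreal (indicator {0<..<1} y * y + indicator {1..} y * (1 + ln y)) \<partial>n2) < \<infinity>" .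
  show "AE y in n2. 0 \<le> 1 - exp (-l*y) \<and>
      1 - exp (-l*y) \<le> (1 + l) * (indicator {0<..<1} y * y + indicator {1..} y * (1 + ln y))"
    using AE_pos_of_null_atMost[OF \<open>sets n2 = sets borel\<close> null]
  proof eventually_elim
    case (elim y)
    have ly: "0 \<le> l * y" using elim assms(2) by simp
    have "1 - exp (-l*y) \<le> (1 + l) * (indicator {0<..<1} y * y + indicator {1..} y * (1 + ln y))"
    proof (cases "y < 1")
      case True
      have "1 - exp (-l*y) \<le> l * y" using exp_ge_add_one_self[of "-l*y"] by simp
      also have "\<dots> \<le> (1 + l) * y" using elim by simp
      finally show ?thesis using True elim by (simp add: indicator_def)
    next
      case False
      have "1 - exp (-l*y) \<le> 1 * 1" by simp
      also have "\<dots> \<le> (1 + l) * (1 + ln y)" using False assms(2) by (intro mult_mono) auto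
      finally show ?thesis using False by (simp add: indicator_def)
    qed
    then show ?case using ly by simp
  qed
qed (use assms(2) in simp)

section \<open>Integrals of the kernel\<close>

lemma integral_kernel_nonneg:
  assumes "sets n = sets borel" and "emeasure n {..0} = 0"
  shows "0 \<le> integral\<^sup>L n cbi_kernel"
  using AE_pos_of_null_atMost[OF assms]
  by (intro integral_nonneg_AE) (auto elim!: eventually_mono intro: less_imp_le cbi_kernel_pos)

lemma null_of_integral_kernel_eq_0:
  assumes "sets n = sets borel" and "emeasure n {..0} = 0"
    and "integrable n cbi_kernel" and "integral\<^sup>L n cbi_kernel = 0"
  shows "emeasure n A = 0"
proof -
  note pos = AE_pos_of_null_atMost[OF assms(1,2)]
  have "AE y in n. 0 \<le> cbi_kernel y"
    using pos by eventually_elim (auto intro: less_imp_le cbi_kernel_pos)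
  then have "AE y in n. cbi_kernel y = 0"
    using integral_nonneg_eq_0_iff_AE[OF assms(3)] assms(4) by simp
  \<comment> \<open>The kernel vanishes almost everywhere, yet is strictly positive almost
    everywhere; only the null measure allows this.\<close>
  with pos have "AE y in n. False"
    by eventually_elim (use cbi_kernel_pos in force)
  then have "emeasure n (space n) = 0"
    by (simp add: AE_iff_null null_sets_def)
  then show ?thesis
    using emeasure_space[of n A] by simp
qed

lemma integral_linear_combination3:
  fixes f g h :: "'a \<Rightarrow> real"
  assumes "integrable M f" and "integrable M g" and "integrable M h"
    and "\<And>x. k x = c * f x + d * g x + e * h x"
  shows "integrable M k"
    and "integral\<^sup>L M k = c * integral\<^sup>L M f + d * integral\<^sup>L M g + e * integral\<^sup>L M h"
proof -
  have k: "k = (\<lambda>x. c * f x + d * g x + e * h x)"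
    using assms(4) by auto
  show "integrable M k"
    "integral\<^sup>L M k = c * integral\<^sup>L M f + d * integral\<^sup>L M g + e * integral\<^sup>L M h"
    unfolding k using assms(1-3) by simp_all
qed

lemma cbi_F_kernel:
  assumes "cbi_admissible n1 n2"
  shows "integrable n2 cbi_kernel"
    and "cbi_F \<delta> n2 4 - 2 * (cbi_F \<delta> n2 3 - cbi_F \<delta> n2 1) = integral\<^sup>L n2 cbi_kernel"
proof -
  have int: "integrable n2 (\<lambda>y. 1 - exp (-l*y))" if "0 \<le> l" for l
    using cbi_F_integrable[OF assms that] .
  \<comment> \<open>The forms \<open>1 *\<close> and \<open>-1*y\<close> let the equation unify with
    the premise of \<open>integral_linear_combination3\<close>.\<close>
  have eq: "cbi_kernel y = 1 * (1 - exp (-4*y)) + (-2) * (1 - exp (-3*y)) + 2 * (1 - exp (-1*y))"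
    for y by (simp add: cbi_kernel_eq)
  note comb = integral_linear_combination3[OF int int int eq]
  show "integrable n2 cbi_kernel"
    by (rule comb(1)) auto
  define I where "I l = (\<integral>y. 1 - exp (-l*y) \<partial>n2)" for l
  have "integral\<^sup>L n2 cbi_kernel = 1 * I 4 + (-2) * I 3 + 2 * I 1"
    unfolding I_def by (rule comb(2)) auto
  then show "cbi_F \<delta> n2 4 - 2 * (cbi_F \<delta> n2 3 - cbi_F \<delta> n2 1) = integral\<^sup>L n2 cbi_kernel"
    unfolding cbi_F_def I_def[symmetric] by simp
qed

text \<open>The compensator terms cancel, since -4 + 2*3 - 2*1 = 0. The minus sign before the
  integral in \<open>cbi_R\<close> gives the same kernel with the same sign as for
  \<open>n2\<close>, so the two contributions cannot offset each other.\<close>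

lemma cbi_R_kernel:
  assumes "cbi_admissible n1 n2"
  shows "integrable n1 cbi_kernel"
    and "cbi_R a b n1 4 - 2 * (cbi_R a b n1 3 - cbi_R a b n1 1) = integral\<^sup>L n1 cbi_kernel"
proof -
  have int: "integrable n1 (\<lambda>y. exp (-l*y) - 1 + l*y)" if "0 \<le> l" for l
    using cbi_R_integrable[OF assms that] .
  have eq: "cbi_kernel y = (-1) * (exp (-4*y) - 1 + 4*y) + 2 * (exp (-3*y) - 1 + 3*y)
      + (-2) * (exp (-1*y) - 1 + 1*y)" for y
    by (simp add: cbi_kernel_eq)
  note comb = integral_linear_combination3[OF int int int eq]
  show "integrable n1 cbi_kernel"
    by (rule comb(1)) auto
  define I where "I l = (\<integral>y. exp (-l*y) - 1 + l*y \<partial>n1)" for l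
  have "integral\<^sup>L n1 cbi_kernel = (-1) * I 4 + 2 * I 3 + (-2) * I 1"
    unfolding I_def by (rule comb(2)) auto
  then show "cbi_R a b n1 4 - 2 * (cbi_R a b n1 3 - cbi_R a b n1 1) = integral\<^sup>L n1 cbi_kernel"
    unfolding cbi_R_def I_def[symmetric] by simp
qed

section \<open>Laplace transforms of probability measures on the half-line\<close>

lemma mult_exp_minus_le_1:
  fixes u :: real
  assumes "0 \<le> u"
  shows "u * exp (-u) \<le> 1"
proof -
  have "u \<le> exp u" using exp_ge_add_one_self[of u] by linarith
  then show ?thesis by (simp add: exp_minus field_simps)
qed

lemma prob_space_eq_return:
  fixes c :: real
  assumes "prob_space M" and "sets M = sets borel" and "AE x in M. x = c"
  shows "M = return borel c"
proof (rule measure_eqI)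
  interpret prob_space M by fact
  fix A assume A: "A \<in> sets M"
  have "emeasure M A = (\<integral>\<^sup>+ x. indicator A x \<partial>M)"
    using A by simp
  also have "\<dots> = (\<integral>\<^sup>+ x. indicator A c \<partial>M)"
    using assms(3) by (intro nn_integral_cong_AE) (auto elim: eventually_mono)
  also have "\<dots> = emeasure (return borel c) A"
    using A assms(2) by (simp add: emeasure_space_1)
  finally show "emeasure M A = emeasure (return borel c) A" .
qed (simp add: assms(2))

locale prob_space_nonneg_reals = prob_space \<nu> for \<nu> :: "real measure" +
  assumes sets_borel [measurable_cong]: "sets \<nu> = sets borel"
    and null_neg: "emeasure \<nu> {..<0} = 0"
begin

definition G :: "real \<Rightarrow> real" where "G l = (\<integral>x. exp (-l*x) \<partial>\<nu>)"

text \<open>For \<open>0 < l\<close> this is minus the derivative of the Laplace transform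
  \<open>G\<close>; the integral form avoids differentiating under the integral.\<close>

definition H :: "real \<Rightarrow> real" where "H l = (\<integral>x. x * exp (-l*x) \<partial>\<nu>)"

lemma AE_nonneg: "AE x in \<nu>. 0 \<le> x"
  by (rule AE_I[where N="{..<0}"]) (auto simp: null_neg sets_borel not_le)

lemma integrable_exp: "0 \<le> l \<Longrightarrow> integrable \<nu> (\<lambda>x. exp (-l*x))"
  using AE_nonneg by (intro integrable_const_bound[where B=1]) (auto elim!: eventually_mono)

text \<open>The exponential tames the factor \<open>x\<close>: the integrand is bounded by 1/l, so
  no moment of \<open>\<nu>\<close> is required.\<close>

lemma integrable_mult_exp:
  assumes "0 < l" shows "integrable \<nu> (\<lambda>x. x * exp (-l*x))"
proof (rule integrable_const_bound[where B="1/l"])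
  show "AE x in \<nu>. norm (x * exp (-l*x)) \<le> 1/l"
    using AE_nonneg
  proof eventually_elim
    case (elim x)
    then show ?case
      using mult_exp_minus_le_1[of "l*x"] assms by (simp add: abs_mult field_simps)
  qed
qed measurable

lemma G_pos: assumes "0 \<le> l" shows "0 < G l"
proof -
  have "G l \<noteq> 0"
  proof
    assume "G l = 0"
    then have "AE x in \<nu>. exp (-l*x) = 0"
      using integral_nonneg_eq_0_iff_AE[OF integrable_exp[OF assms]] by (simp add: G_def)
    then show False by (simp add: AE_False emeasure_space_1)
  qed
  moreover have "0 \<le> G l" unfolding G_def by (rule integral_nonneg_AE) simp
  ultimately show ?thesis by simp
qed

text \<open>A nonnegative integrand with integral 0 would force \<open>x = 0\<close> almost surely,
  that is, a point mass at 0.\<close>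

lemma H_pos:
  assumes "0 < l" and "\<nu> \<noteq> return borel 0" shows "0 < H l"
proof -
  have nn: "AE x in \<nu>. 0 \<le> x * exp (-l*x)"
    using AE_nonneg by (auto elim: eventually_mono)
  have "H l \<noteq> 0"
  proof
    assume "H l = 0"
    then have "AE x in \<nu>. x * exp (-l*x) = 0"
      using integral_nonneg_eq_0_iff_AE[OF integrable_mult_exp[OF assms(1)] nn]
      by (simp add: H_def)
    then show False
      using prob_space_eq_return[OF prob_space_axioms sets_borel, of 0] assms(2) by simp
  qed
  moreover have "0 \<le> H l" unfolding H_def by (rule integral_nonneg_AE[OF nn])
  ultimately show ?thesis by simp
qed

text \<open>Instead of solving the differential equation -G' = c G, the proof compares only
  \<open>l = 1\<close> and \<open>l = 2\<close>. The resulting function \<open>k\<close> has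
  integral 0 and is nonnegative, because \<open>x - c\<close> and \<open>exp (-c) - exp (-x)\<close>
  have the same sign; it vanishes only at \<open>c\<close>.\<close>

lemma eq_return_of_H_eq_G:
  assumes "\<And>l. 0 < l \<Longrightarrow> H l = c * G l"
  shows "\<nu> = return borel c"
proof -
  define k where "k x = (x - c) * exp (-x) * (exp (-c) - exp (-x))" for x
  have centred: "integrable \<nu> (\<lambda>x. (x - c) * exp (-l*x))"
    "(\<integral>x. (x - c) * exp (-l*x) \<partial>\<nu>) = 0" if "0 < l" for l
    using integrable_exp[of l] integrable_mult_exp[OF that] that assms[OF that]
    by (simp_all add: left_diff_distrib G_def H_def)
  have k_eq: "k x = exp (-c) * ((x - c) * exp (-1*x)) - (x - c) * exp (-2*x)" for x
  proof -
    have "exp (-2*x) = exp (-x) * exp (-x)" by (simp flip: exp_add)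
    then show ?thesis by (simp add: k_def algebra_simps)
  qed
  have k_int: "integrable \<nu> k"
    unfolding k_eq[abs_def] using centred(1)[of 1] centred(1)[of 2]
    by (intro Bochner_Integration.integrable_diff integrable_mult_right) auto
  have "integral\<^sup>L \<nu> k = exp (-c) * (\<integral>x. (x - c) * exp (-1*x) \<partial>\<nu>)
      - (\<integral>x. (x - c) * exp (-2*x) \<partial>\<nu>)"
    unfolding k_eq[abs_def] integral_mult_right_zero[symmetric]
    using centred(1)[of 1] centred(1)[of 2]
    by (intro Bochner_Integration.integral_diff integrable_mult_right) auto
  also have "\<dots> = 0"
    using centred(2)[of 1] centred(2)[of 2] by simp
  finally have "integral\<^sup>L \<nu> k = 0" .
  moreover have "0 \<le> k x" for x
  proof -
    have "0 \<le> (x - c) * (exp (-c) - exp (-x))"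
      by (cases "x \<le> c") (simp_all add: mult_nonpos_nonpos)
    then have "0 \<le> (x - c) * (exp (-c) - exp (-x)) * exp (-x)" by simp
    then show ?thesis by (simp only: k_def mult_ac)
  qed
  ultimately have "AE x in \<nu>. k x = 0"
    using integral_nonneg_eq_0_iff_AE[OF k_int] by simp
  then have "AE x in \<nu>. x = c"
    by eventually_elim (auto simp: k_def)
  then show ?thesis by (rule prob_space_eq_return[OF prob_space_axioms sets_borel])
qed

section \<open>Limits as the exponent tends to 0\<close>

lemma G_tendsto_1: "(\<lambda>n. G (1 / Suc n)) \<longlonglongrightarrow> 1"
proof -
  have "(\<lambda>n. \<integral>x. exp (-(1 / Suc n)*x) \<partial>\<nu>) \<longlonglongrightarrow> (\<integral>x. 1 \<partial>\<nu>)"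
  proof (rule integral_dominated_convergence[where w="\<lambda>_. 1"])
    fix n
    show "AE x in \<nu>. norm (exp (-(1 / Suc n)*x)) \<le> 1"
      using AE_nonneg by (auto elim!: eventually_mono)
  next
    show "AE x in \<nu>. (\<lambda>n. exp (-(1 / Suc n)*x)) \<longlonglongrightarrow> 1"
      by (intro AE_I2) (rule tendsto_eq_intros LIMSEQ_Suc[OF lim_1_over_n] refl | simp)+
  qed auto
  then show ?thesis by (simp add: G_def prob_space)
qed

text \<open>The mean of \<open>\<nu>\<close> may be infinite, so \<open>H\<close> itself may blow up
  at 0; but l x exp(-l x) is bounded by 1 and tends to 0 pointwise, and dominated convergence
  applies.\<close>

lemma scaled_H_tendsto_0: "(\<lambda>n. 1 / Suc n * H (1 / Suc n)) \<longlonglongrightarrow> 0"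
proof -
  have "(\<lambda>n. \<integral>x. 1 / Suc n * (x * exp (-(1 / Suc n)*x)) \<partial>\<nu>) \<longlonglongrightarrow> (\<integral>x. 0 \<partial>\<nu>)"
  proof (rule integral_dominated_convergence[where w="\<lambda>_. 1"])
    fix n
    show "AE x in \<nu>. norm (1 / Suc n * (x * exp (-(1 / Suc n)*x))) \<le> 1"
      using AE_nonneg
    proof eventually_elim
      case (elim x)
      then show ?case using mult_exp_minus_le_1[of "1 / Suc n * x"] by (simp add: abs_mult)
    qed
  next
    show "AE x in \<nu>. (\<lambda>n. 1 / Suc n * (x * exp (-(1 / Suc n)*x))) \<longlonglongrightarrow> 0"
      by (intro AE_I2) (rule tendsto_eq_intros LIMSEQ_Suc[OF lim_1_over_n] refl | simp)+
  qed auto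
  then show ?thesis by (simp add: H_def)
qed

section \<open>Identities from stationarity and symmetry\<close>

lemma cbi_gen_exp_integral:
  assumes "0 \<le> l" and "0 \<le> m" and "0 < l + m"
  shows "(\<integral>x. cbi_gen a b \<delta> n1 n2 (\<lambda>x. exp (-l*x)) x * exp (-m*x) \<partial>\<nu>)
    = - cbi_R a b n1 l * H (l + m) - cbi_F \<delta> n2 l * G (l + m)"
proof -
  \<comment> \<open>The weight \<open>exp (-m*x)\<close> shifts the exponent from \<open>l\<close>
    to \<open>l + m\<close>.\<close>
  have "(\<lambda>x. cbi_gen a b \<delta> n1 n2 (\<lambda>x. exp (-l*x)) x * exp (-m*x))
    = (\<lambda>x. - cbi_R a b n1 l * (x * exp (-(l+m)*x)) - cbi_F \<delta> n2 l * exp (-(l+m)*x))"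
    unfolding cbi_gen_exp by (simp add: fun_eq_iff algebra_simps flip: exp_add)
  then show ?thesis
    using integrable_exp[of "l+m"] integrable_mult_exp[of "l+m"] assms
    by (simp add: G_def H_def)
qed

lemma reversible_stationary:
  assumes "cbi_reversible a b \<delta> n1 n2 \<nu>" and "0 < l"
  shows "cbi_R a b n1 l * H l + cbi_F \<delta> n2 l * G l = 0"
proof -
  have "(\<integral>x. cbi_gen a b \<delta> n1 n2 (\<lambda>x. exp (-l*x)) x \<partial>\<nu>) = 0"
    using assms unfolding cbi_reversible_def by (metis less_imp_le)
  then show ?thesis
    \<comment> \<open>With \<open>m = 0\<close> the weight is 1.\<close>
    using cbi_gen_exp_integral[of l 0 a b \<delta> n1 n2] assms(2) by simp
qed

lemma reversible_symmetric:
  assumes "cbi_reversible a b \<delta> n1 n2 \<nu>" and "0 < l" and "0 < m"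
  shows "(cbi_R a b n1 l - cbi_R a b n1 m) * H (l + m)
    + (cbi_F \<delta> n2 l - cbi_F \<delta> n2 m) * G (l + m) = 0"
proof -
  obtain D where D: "\<forall>l\<ge>0. (\<lambda>x. exp (-l*x)) \<in> D"
    and sym: "\<forall>f\<in>D. \<forall>g\<in>D. (\<integral>x. cbi_gen a b \<delta> n1 n2 f x * g x \<partial>\<nu>)
      = (\<integral>x. f x * cbi_gen a b \<delta> n1 n2 g x \<partial>\<nu>)"
    using assms(1) unfolding cbi_reversible_def by blast
  have "- cbi_R a b n1 l * H (l + m) - cbi_F \<delta> n2 l * G (l + m)
      = (\<integral>x. cbi_gen a b \<delta> n1 n2 (\<lambda>x. exp (-l*x)) x * exp (-m*x) \<partial>\<nu>)"
    by (rule cbi_gen_exp_integral[symmetric]) (use assms(2,3) in auto)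
  also have "\<dots> = (\<integral>x. exp (-l*x) * cbi_gen a b \<delta> n1 n2 (\<lambda>x. exp (-m*x)) x \<partial>\<nu>)"
    by (rule bspec[OF bspec[OF sym]]; rule D[rule_format]) (use assms(2,3) in auto)
  also have "\<dots> = (\<integral>x. cbi_gen a b \<delta> n1 n2 (\<lambda>x. exp (-m*x)) x * exp (-l*x) \<partial>\<nu>)"
    by (simp add: mult.commute)
  also have "\<dots> = - cbi_R a b n1 m * H (m + l) - cbi_F \<delta> n2 m * G (m + l)"
    by (rule cbi_gen_exp_integral) (use assms(2,3) in auto)
  finally show ?thesis
    by (simp add: add.commute[of m l] algebra_simps)
qed

end

theorem theorem2p3:
  fixes a b \<delta> :: real and n1 n2 :: "real measure"
  assumes "a \<ge> 0" and "b \<ge> 0" and "\<delta> \<ge> 0"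
    and "cbi_admissible n1 n2"
    and "\<exists>l\<ge>0. cbi_R a b n1 l \<noteq> 0"
    and "\<exists>l\<ge>0. cbi_F \<delta> n2 l \<noteq> 0"
    and "cbi_reversible a b \<delta> n1 n2 \<nu>"
    and "\<not> (\<exists>c. \<nu> = return borel c)"
  shows "(\<forall>A. emeasure n1 A = 0) \<and> (\<forall>A. emeasure n2 A = 0) \<and> a > 0 \<and> b > 0 \<and> \<delta> > 0"
proof -
  interpret prob_space_nonneg_reals \<nu>
    using assms(7)
    by (auto simp: cbi_reversible_def prob_space_nonneg_reals_def prob_space_nonneg_reals_axioms_def)
  have n: "sets n1 = sets borel" "emeasure n1 {..0} = 0"
    "sets n2 = sets borel" "emeasure n2 {..0} = 0"
    using assms(4) by (auto simp: cbi_admissible_def)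
  note stat = reversible_stationary[OF assms(7)]
  \<comment> \<open>Because 3 + 1 = 4, both identities involve the transforms only at 4 and can be
    combined.\<close>
  have "(cbi_R a b n1 4 - 2 * (cbi_R a b n1 3 - cbi_R a b n1 1)) * H 4
      + (cbi_F \<delta> n2 4 - 2 * (cbi_F \<delta> n2 3 - cbi_F \<delta> n2 1)) * G 4 = 0"
    using stat[of 4] reversible_symmetric[OF assms(7), of 3 1] by (simp add: algebra_simps)
  then have sum: "integral\<^sup>L n1 cbi_kernel * H 4 + integral\<^sup>L n2 cbi_kernel * G 4 = 0"
    unfolding cbi_R_kernel(2)[OF assms(4)] cbi_F_kernel(2)[OF assms(4)] .
  have HG: "0 < H 4" "0 < G 4"
    using H_pos[of 4] G_pos[of 4] assms(8) by auto
  then have "0 \<le> integral\<^sup>L n1 cbi_kernel * H 4" "0 \<le> integral\<^sup>L n2 cbi_kernel * G 4"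
    using integral_kernel_nonneg n by auto
  with sum have "integral\<^sup>L n1 cbi_kernel * H 4 = 0" "integral\<^sup>L n2 cbi_kernel * G 4 = 0"
    by linarith+
  with HG have null: "emeasure n1 A = 0" "emeasure n2 A = 0" for A
    using null_of_integral_kernel_eq_0 n cbi_R_kernel(1)[OF assms(4)]
      cbi_F_kernel(1)[OF assms(4)] by auto
  \<comment> \<open>For a null measure every property holds almost everywhere, in particular that
    the integrands of \<open>cbi_R\<close> and \<open>cbi_F\<close> are 0.\<close>
  have AE: "AE y in n1. P y" "AE y in n2. P y" for P
    by (rule AE_I[where N="space n1"] AE_I[where N="space n2"]; auto simp: null)+
  have R: "cbi_R a b n1 l = - a * l^2 - b * l" for l
    using integral_eq_zero_AE[OF AE(1)] by (simp add: cbi_R_def)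
  have F: "cbi_F \<delta> n2 l = \<delta> * l" for l
    using integral_eq_zero_AE[OF AE(2)] by (simp add: cbi_F_def)
  have \<delta>: "\<delta> > 0"
    using assms(3,6) by (auto simp: F)
  have ab: "a \<noteq> 0 \<or> b \<noteq> 0"
    using assms(5) by (auto simp: R)
  have eq: "(a * l + b) * H l = \<delta> * G l" if "0 < l" for l
  proof -
    have "l * ((a * l + b) * H l) = l * (\<delta> * G l)"
      using stat[OF that] by (simp add: R F algebra_simps power2_eq_square)
    then show ?thesis using that by simp
  qed
  have "a \<noteq> 0"
  proof
    assume "a = 0"
    with ab have "b \<noteq> 0" by simp
    \<comment> \<open>Without diffusion, \<open>\<nu>\<close> would be the point mass at the
      equilibrium \<open>\<delta> / b\<close> of the drift.\<close>
    with eq \<open>a = 0\<close> have "H l = \<delta> / b * G l" if "0 < l" for l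
      using that by (simp add: field_simps)
    then show False using eq_return_of_H_eq_G assms(8) by blast
  qed
  moreover have "b \<noteq> 0"
  proof
    assume "b = 0"
    \<comment> \<open>At l = 1 / Suc n the identity reads a l H(l) = \<open>\<delta>\<close> G(l);
      the left side tends to 0 and the right side to \<open>\<delta>\<close>.\<close>
    then have "(\<lambda>n. a * (1 / Suc n * H (1 / Suc n))) = (\<lambda>n. \<delta> * G (1 / Suc n))"
      using eq[of "1 / Suc n" for n] by (simp add: fun_eq_iff mult.assoc)
    moreover have "(\<lambda>n. a * (1 / Suc n * H (1 / Suc n))) \<longlonglongrightarrow> a * 0"
      by (intro tendsto_intros scaled_H_tendsto_0)
    moreover have "(\<lambda>n. \<delta> * G (1 / Suc n)) \<longlonglongrightarrow> \<delta> * 1"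
      by (intro tendsto_intros G_tendsto_1)
    ultimately have "\<delta> = 0" using LIMSEQ_unique by fastforce
    with \<delta> show False by simp
  qed
  ultimately show ?thesis
    using null \<delta> assms(1,2) by auto
qed

end
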